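(* Let $X \subseteq \{0,1\}^{\mathbb{Z}}$ be an aperiodic subshift. Then $(X,S)$ is a minimal Ferenczi subshift if and only if there exists a standard sequence of generating words $\mathcal{W}$, with cutting parameters $(q_n)_{n\ge 0}$ and bounded spacer parameters $(a_{n,i} : n \ge 0,\ 0 \le i < q_n)$, such that $X$ is the $\mathcal{S}$-adic subshift $X_{\boldsymbol{\tau}_{\mathcal{W}}}$ generated by the directive sequence $\boldsymbol{\tau}_{\mathcal{W}}$.
   Context: $S$ is the shift map. A subshift is a closed shift-invariant subset of $\mathcal{A}^{\mathbb{Z}}$, $\mathcal{A}$ a finite alphabet; it is aperiodic if it is nonempty and contains no shift-periodic point. Ferenczi subshifts. Given nonnegative integers $(q_n)_{n \ge 0}$ (cutting parameters) and $(a_{n,i} : n \ge 0, 0 \le i < q_n)$ (spacer parameters), the sequence of generating words $\mathcal{W} = (w_n)_{n \ge 0}$ over $\{0,1\}$ is given by $w_0 = 0$ and $w_{n+1} = w_n 1^{a_{n,0}} w_n 1^{a_{n,1}} \cdots w_n 1^{a_{n,q_n-1}} w_n$. The Ferenczi subshift $X_{\mathcal{W}}$ is the set of $x \in \{0,1\}^{\mathbb{Z}}$ such that every finite factor of $x$ is a factor of some $w_n$. A minimal Ferenczi subshift is a subshift of the form $X_{\mathcal{W}}$ for which the spacer sequence $(a_{n,i})$ is bounded. $\mathcal{W}$ is standard if $q_n \ge 2$ for all $n \ge 0$. $\mathcal{S}$-adic subshifts. A directive sequence is a sequence $\boldsymbol{\tau} = (\tau_n : \mathcal{A}_{n+1}^*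 \to \mathcal{A}_n^* )_{n \ge 0}$ of nonerasing morphisms between free monoids on finite alphabets. For $0 \le n \le N$, $\tau_{[n,N)} = \tau_n \circ \cdots \circ \tau_{N-1}$ (identity if $n=N$). $X_{\boldsymbol{\tau}}$ is the set of $x \in \mathcal{A}_0^{\mathbb{Z}}$ all of whose finite factors occur in $\tau_{[0,N)}(a)$ for some $N > 0$ and $a \in \mathcal{A}_N$. The directive sequence $\boldsymbol{\tau}_{\mathcal{W}}$. For $\mathcal{W}$ standard with bounded spacers, put $\mathcal{A}_0 = \{0,1\}$ and $\mathcal{A}_n = \{a_{N,i} : N \ge n-1,\ 0 \le i < q_N\}$ for $n \ge 1$ (integers viewed as letters). Then $\boldsymbol{\tau}_{\mathcal{W}} = (\tau_n : \mathcal{A}_{n+1}^* \to \mathcal{A}_n^* )_{n \ge 0}$ with $\tau_0(a) = 0 1^a$ for $a \in \mathcal{A}_1$ and, for $n \ge 1$ and $a \in \mathcal{A}_{n+1}$, $\tau_n(a) = a_{n-1,1} a_{n-1,2} \cdots a_{n-1,q_{n-1}-1}\, a\, a_{n-1,0}$ (a word in the letters $\mathcal{A}_n$). *)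

theory Defs
  imports "HOL-Analysis.Function_Topology" "HOL-Library.Sublist"
begin

section \<open>Subshifts\<close>

definition shift :: "(int \<Rightarrow> 'a) \<Rightarrow> int \<Rightarrow> 'a" where
  "shift x = (\<lambda>k. x (k + 1))"

text \<open>The topology on \<open>int \<Rightarrow> 'a\<close> is the product of the discrete topologies. For finite \<open>A\<close>
  the sequences over \<open>A\<close> form a closed set, so being closed in that set and being closed in the
  whole type mean the same.\<close>

definition subshift :: "'a::discrete_topology set \<Rightarrow> (int \<Rightarrow> 'a) set \<Rightarrow> bool" where
  "subshift A X \<longleftrightarrow> finite A \<and> (\<forall>x\<in>X. range x \<subseteq> A) \<and> closed X \<and> shift ` X = X"

definition aperiodic :: "(int \<Rightarrow> 'a) set \<Rightarrow> bool" where
  "aperiodic X \<longleftrightarrow> X \<noteq> {} \<and> \<not> (\<exists>x\<in>X. \<exists>p>0. (shift ^^ p) x = x)"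

definition factors :: "(int \<Rightarrow> 'a) \<Rightarrow> 'a list set" where
  "factors x = {map x [i..j] | i j. True}"

section \<open>Ferenczi subshifts\<close>

text \<open>The cutting parameters are \<open>q n\<close>, the spacer parameters are \<open>a n i\<close> with \<open>i < q n\<close>; the
  values of \<open>a n i\<close> for \<open>i \<ge> q n\<close> are never used.\<close>

primrec gen_word :: "(nat \<Rightarrow> nat) \<Rightarrow> (nat \<Rightarrow> nat \<Rightarrow> nat) \<Rightarrow> nat \<Rightarrow> nat list" where
  "gen_word q a 0 = [0]"
| "gen_word q a (Suc n) =
     concat (map (\<lambda>i. gen_word q a n @ replicate (a n i) 1) [0..<q n]) @ gen_word q a n"

definition ferenczi_subshift :: "(nat \<Rightarrow> nat) \<Rightarrow> (nat \<Rightarrow> nat \<Rightarrow> nat) \<Rightarrow> (int \<Rightarrow> nat) set" where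
  "ferenczi_subshift q a =
     {x. range x \<subseteq> {0, 1} \<and> (\<forall>u\<in>factors x. \<exists>n. sublist u (gen_word q a n))}"

definition bounded_spacers :: "(nat \<Rightarrow> nat) \<Rightarrow> (nat \<Rightarrow> nat \<Rightarrow> nat) \<Rightarrow> bool" where
  "bounded_spacers q a \<longleftrightarrow> (\<exists>B. \<forall>n. \<forall>i<q n. a n i \<le> B)"

definition standard :: "(nat \<Rightarrow> nat) \<Rightarrow> bool" where
  "standard q \<longleftrightarrow> (\<forall>n. q n \<ge> 2)"

definition minimal_ferenczi_subshift :: "(int \<Rightarrow> nat) set \<Rightarrow> bool" where
  "minimal_ferenczi_subshift X \<longleftrightarrow>
     subshift {0, 1} X \<and> (\<exists>q a. bounded_spacers q a \<and> X = ferenczi_subshift q a)"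

section \<open>S-adic subshifts\<close>

text \<open>A morphism of free monoids is given by its values on letters.\<close>

definition morphism :: "('a \<Rightarrow> 'b list) \<Rightarrow> 'a list \<Rightarrow> 'b list" where
  "morphism f u = concat (map f u)"

definition directive_sequence :: "(nat \<Rightarrow> 'a set) \<Rightarrow> (nat \<Rightarrow> 'a \<Rightarrow> 'a list) \<Rightarrow> bool" where
  "directive_sequence A \<tau> \<longleftrightarrow>
     (\<forall>n. finite (A n)) \<and> (\<forall>n. \<forall>b\<in>A (Suc n). \<tau> n b \<in> lists (A n) \<and> \<tau> n b \<noteq> [])"

definition compose_range :: "(nat \<Rightarrow> 'a \<Rightarrow> 'a list) \<Rightarrow> nat \<Rightarrow> nat \<Rightarrow> 'a list \<Rightarrow> 'a list" where
  "compose_range \<tau> n N = foldr (\<lambda>k f. morphism (\<tau> k) \<circ> f) [n..<N] id"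

definition sadic_subshift :: "(nat \<Rightarrow> 'a set) \<Rightarrow> (nat \<Rightarrow> 'a \<Rightarrow> 'a list) \<Rightarrow> (int \<Rightarrow> 'a) set" where
  "sadic_subshift A \<tau> =
     {x. range x \<subseteq> A 0 \<and>
         (\<forall>u\<in>factors x. \<exists>N>0. \<exists>b\<in>A N. sublist u (compose_range \<tau> 0 N [b]))}"

section \<open>The directive sequence of a sequence of generating words\<close>

primrec ferenczi_alphabet :: "(nat \<Rightarrow> nat) \<Rightarrow> (nat \<Rightarrow> nat \<Rightarrow> nat) \<Rightarrow> nat \<Rightarrow> nat set" where
  "ferenczi_alphabet q a 0 = {0, 1}"
| "ferenczi_alphabet q a (Suc n) = {a N i | N i. N \<ge> n \<and> i < q N}"

primrec ferenczi_directive ::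
  "(nat \<Rightarrow> nat) \<Rightarrow> (nat \<Rightarrow> nat \<Rightarrow> nat) \<Rightarrow> nat \<Rightarrow> nat \<Rightarrow> nat list" where
  "ferenczi_directive q a 0 b = 0 # replicate b 1"
| "ferenczi_directive q a (Suc n) b = map (a n) [1..<q n] @ [b, a n 0]"

lemma directive_sequence_ferenczi:
  assumes "standard q" "bounded_spacers q a"
  shows "directive_sequence (ferenczi_alphabet q a) (ferenczi_directive q a)"
  unfolding directive_sequence_def
proof (intro conjI allI ballI)
  obtain B where B: "\<And>n i. i < q n \<Longrightarrow> a n i \<le> B"
    using assms(2) by (auto simp: bounded_spacers_def)
  have q: "0 < q n" for n
    using assms(1) unfolding standard_def by (metis less_le_trans pos2)
  fix n
  show "finite (ferenczi_alphabet q a n)"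
  proof (cases n)
    case (Suc m)
    then have "ferenczi_alphabet q a n \<subseteq> {..B}" using B by auto
    then show ?thesis by (rule finite_subset) simp
  qed simp
  fix b assume b: "b \<in> ferenczi_alphabet q a (Suc n)"
  show "ferenczi_directive q a n b \<in> lists (ferenczi_alphabet q a n)"
  proof (cases n)
    case 0
    then show ?thesis by (auto simp: in_lists_conv_set)
  next
    case (Suc m)
    then have "b \<in> ferenczi_alphabet q a n"
      using b by fastforce
    moreover have "a m i \<in> ferenczi_alphabet q a n" if "i < q m" for i
      using that Suc by auto
    ultimately show ?thesis
      using Suc q[of m] by (auto simp: in_lists_conv_set simp del: ferenczi_alphabet.simps)
  qed
  show "ferenczi_directive q a n b \<noteq> []"
    by (cases n) auto
qed

end

theory Submission
  imports Defs
begin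

text \<open>The composition \<open>\<tau>\<^sub>0 \<circ> \<dots> \<circ> \<tau>\<^sub>n\<close> sends a letter \<open>b\<close> to a conjugate of \<open>w\<^sub>n 1\<^sup>b\<close>, where the
  conjugating word is a prefix of \<open>w\<^sub>n\<close> that does not depend on \<open>b\<close>. Hence, for a standard \<open>W\<close>, the
  images of the letters and the words \<open>w\<^sub>n\<close> have the same factors, so that the two subshifts agree.
  It remains to make an arbitrary sequence of generating words standard. If \<open>X\<^sub>W\<close> is nonempty, then
  the lengths of the \<open>w\<^sub>n\<close> are unbounded, and as the spacers are bounded a sufficiently sparse
  subsequence of \<open>W\<close> is again a sequence of generating words, now with at least two cuts per step.\<close>

section \<open>Words cut into copies of a fixed word\<close>

definition spaced :: "nat list \<Rightarrow> nat list \<Rightarrow> nat list" where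
  "spaced w s = concat (map (\<lambda>c. w @ replicate c 1) s) @ w"

lemma spaced_Nil [simp]: "spaced w [] = w"
  and spaced_Cons: "spaced w (c # s) = w @ replicate c 1 @ spaced w s"
  by (simp_all add: spaced_def)

lemma spaced_append: "spaced w (s @ c # t) = spaced w s @ replicate c 1 @ spaced w t"
  by (induction s) (simp_all add: spaced_Cons)

text \<open>Each copy of the inner word contributes its own spacers \<open>s\<close>, and each outer
  spacer separates two such copies. Cutting twice is thus one cutting, which is what makes it
  possible to skip levels of a sequence of generating words.\<close>

lemma spaced_spaced: "spaced (spaced w s) t = spaced w (concat (map (\<lambda>c. s @ [c]) t) @ s)"
  by (induction t) (simp_all add: spaced_Cons spaced_append)

lemma prefix_spaced: "prefix w (spaced w s)"
  by (cases s) (simp_all add: spaced_Cons)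

lemma suffix_spaced: "suffix w (spaced w s)"
  by (simp add: spaced_def suffix_def)

lemma sublist_spaced:
  assumes "c \<in> set s"
  shows "sublist (w @ replicate c 1 @ w) (spaced w s)"
proof -
  obtain s1 s2 where "s = s1 @ c # s2"
    using assms by (auto simp: in_set_conv_decomp)
  moreover obtain v where "spaced w s1 = v @ w"
    using suffix_spaced by (auto simp: suffix_def)
  moreover obtain v' where "spaced w s2 = w @ v'"
    using prefix_spaced by (auto simp: prefix_def)
  ultimately have "spaced w s = v @ (w @ replicate c 1 @ w) @ v'"
    by (simp add: spaced_append)
  then show ?thesis by (auto simp: sublist_def)
qed

lemma gen_word_Suc: "gen_word q a (Suc n) = spaced (gen_word q a n) (map (a n) [0..<q n])"
  by (simp add: spaced_def comp_def)

declare gen_word.simps(2) [simp del]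

text \<open>Merging levels creates no new spacer values, so a bound on the spacers survives the
  passage to a subsequence.\<close>

lemma gen_word_spaced:
  assumes "m \<le> n"
  shows "\<exists>s. set s \<subseteq> {a N i | N i. i < q N} \<and> gen_word q a n = spaced (gen_word q a m) s"
  using assms
proof (induction n rule: dec_induct)
  case base
  then show ?case by (intro exI[of _ "[]"]) simp
next
  case (step n)
  then obtain s where "set s \<subseteq> {a N i | N i. i < q N}" "gen_word q a n = spaced (gen_word q a m) s"
    by blast
  then show ?case
    by (intro exI[of _ "concat (map (\<lambda>c. s @ [c]) (map (a n) [0..<q n])) @ s"])
      (fastforce simp: gen_word_Suc spaced_spaced)
qed

lemma
  assumes "m \<le> n"
  shows prefix_gen_word: "prefix (gen_word q a m) (gen_word q a n)"
    and suffix_gen_word: "suffix (gen_word q a m) (gen_word q a n)"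
  using gen_word_spaced[OF assms, of a q] prefix_spaced suffix_spaced by metis+

text \<open>The word w_N both begins and ends with w_n, so a spacer of any later level is flanked by
  copies of w_n. This matches the alphabet of level n+1, which collects the spacers of all levels
  \<open>N \<ge> n\<close>.\<close>

lemma sublist_gen_word_spacer:
  assumes "n \<le> N" "i < q N"
  shows "sublist (gen_word q a n @ replicate (a N i) 1 @ gen_word q a n) (gen_word q a (Suc N))"
proof -
  let ?w = "gen_word q a n" and ?W = "gen_word q a N"
  obtain v v' where v: "?W = v @ ?w" and v': "?W = ?w @ v'"
    using suffix_gen_word[OF assms(1)] prefix_gen_word[OF assms(1)]
    by (metis prefix_def suffix_def)
  have "?W @ replicate (a N i) 1 @ ?W = v @ (?w @ replicate (a N i) 1 @ ?w) @ v'"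
    by (subst v, subst v') simp
  then have "sublist (?w @ replicate (a N i) 1 @ ?w) (?W @ replicate (a N i) 1 @ ?W)"
    unfolding sublist_def by blast
  also have "sublist \<dots> (gen_word q a (Suc N))"
    unfolding gen_word_Suc using assms(2) by (intro sublist_spaced) auto
  finally show ?thesis .
qed

section \<open>The S-adic presentation\<close>

text \<open>The fold unfolds at the outermost morphism, whereas induction on the level has to split
  off the innermost one.\<close>

lemma compose_range_Suc:
  "n \<le> N \<Longrightarrow> compose_range \<tau> n (Suc N) u = compose_range \<tau> n N (morphism (\<tau> N) u)"
proof -
  have "foldr (\<lambda>k f. g k \<circ> f) ks h x = foldr (\<lambda>k f. g k \<circ> f) ks id (h x)"
    for g :: "nat \<Rightarrow> 'a list \<Rightarrow> 'a list" and ks h x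
    by (induction ks) simp_all
  then show "n \<le> N \<Longrightarrow> ?thesis" by (simp add: compose_range_def)
qed

lemma conjugate_concat_map:
  assumes "\<And>c. p @ f c = g c @ p"
  shows "p @ concat (map f u) = concat (map g u) @ p"
proof (induction u)
  case (Cons c u)
  have "p @ concat (map f (c # u)) = g c @ p @ concat (map f u)"
    using assms by (simp flip: append_assoc)
  then show ?case using Cons by simp
qed simp

text \<open>The morphism of index n+1 puts the spacer \<open>a n 0\<close> last instead of first.
  Undoing this rotation costs a factor \<open>w_n 1^(a n 0)\<close> at each level, and these factors
  accumulate here.\<close>

primrec conj_prefix :: "(nat \<Rightarrow> nat) \<Rightarrow> (nat \<Rightarrow> nat \<Rightarrow> nat) \<Rightarrow> nat \<Rightarrow> nat list" where
  "conj_prefix q a 0 = []"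
| "conj_prefix q a (Suc n) = gen_word q a n @ replicate (a n 0) 1 @ conj_prefix q a n"

text \<open>By induction, since w_{n+1} begins with \<open>w_n 1^(a n 0) w_n\<close>.\<close>

lemma prefix_conj_prefix:
  assumes "\<And>n. 0 < q n"
  shows "prefix (conj_prefix q a n) (gen_word q a n)"
proof (induction n)
  case (Suc n)
  obtain s where "map (a n) [0..<q n] = a n 0 # s"
    using assms[of n] by (simp add: upt_conv_Cons)
  then have "gen_word q a (Suc n)
      = gen_word q a n @ replicate (a n 0) 1 @ spaced (gen_word q a n) s"
    by (simp add: gen_word_Suc spaced_Cons)
  then show ?case
    using prefix_order.trans[OF Suc prefix_spaced] by simp
qed simp

text \<open>Induction for all words \<open>u\<close> at once, because the hypothesis is applied to
  the image of \<open>u\<close> under the next morphism. The index \<open>Suc n\<close> counts the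
  morphisms 0, ..., n.\<close>

lemma conj_prefix_compose_range:
  assumes "\<And>n. 0 < q n"
  shows "conj_prefix q a n @ compose_range (ferenczi_directive q a) 0 (Suc n) u
    = concat (map (\<lambda>b. gen_word q a n @ replicate b 1) u) @ conj_prefix q a n"
proof (induction n arbitrary: u)
  case 0
  have "ferenczi_directive q a 0 = (\<lambda>b. [0] @ replicate b 1)" by (rule ext) simp
  then show ?case by (simp add: compose_range_def morphism_def)
next
  case (Suc n)
  let ?w = "gen_word q a n" and ?p = "conj_prefix q a n" and ?\<tau> = "ferenczi_directive q a"
  let ?g = "\<lambda>b. ?w @ replicate b 1"
  let ?f = "\<lambda>b. concat (map ?g (?\<tau> (Suc n) b))"
  \<comment> \<open>Moving the block of \<open>a n 0\<close> from the end to the front restores the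
    order of the spacers in w_{n+1}.\<close>
  have conj: "?g (a n 0) @ ?f b = (gen_word q a (Suc n) @ replicate b 1) @ ?g (a n 0)" for b
    using assms[of n] by (simp add: gen_word_Suc spaced_def upt_conv_Cons comp_def)
  have "?p @ compose_range ?\<tau> 0 (Suc (Suc n)) u
      = concat (map ?g (morphism (?\<tau> (Suc n)) u)) @ ?p"
    by (subst compose_range_Suc) (simp_all add: Suc)
  also have "concat (map ?g (morphism (?\<tau> (Suc n)) u)) = concat (map ?f u)"
    unfolding morphism_def by (induction u) simp_all
  finally have "conj_prefix q a (Suc n) @ compose_range ?\<tau> 0 (Suc (Suc n)) u
      = (?g (a n 0) @ concat (map ?f u)) @ ?p"
    by simp
  also have "?g (a n 0) @ concat (map ?f u)
      = concat (map (\<lambda>b. gen_word q a (Suc n) @ replicate b 1) u) @ ?g (a n 0)"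
    by (rule conjugate_concat_map) (rule conj)
  finally show ?case by simp
qed

lemma sublist_compose_range_gen_word:
  assumes "\<And>n. 0 < q n" "n \<le> N" "i < q N"
  shows "sublist (compose_range (ferenczi_directive q a) 0 (Suc n) [a N i]) (gen_word q a (Suc N))"
proof -
  let ?w = "gen_word q a n" and ?p = "conj_prefix q a n"
  let ?T = "compose_range (ferenczi_directive q a) 0 (Suc n) [a N i]"
  obtain r where "?w = ?p @ r"
    using prefix_conj_prefix[of q a n] assms(1) by (auto simp: prefix_def)
  moreover have "?p @ ?T = ?w @ replicate (a N i) 1 @ ?p"
    using conj_prefix_compose_range[of q a n "[a N i]"] assms(1) by simp
  ultimately have "?w @ replicate (a N i) 1 @ ?w = ?p @ ?T @ r"
    by (metis append.assoc)
  then have "sublist ?T (?w @ replicate (a N i) 1 @ ?w)"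
    by (auto simp: sublist_def)
  also have "sublist \<dots> (gen_word q a (Suc N))"
    using assms(2,3) by (rule sublist_gen_word_spacer)
  finally show ?thesis .
qed

text \<open>One more level is composed so that the letter becomes a word of at least two letters at
  level n+1. Cancelling the conjugating prefix damages only the first copy of w_n and leaves the
  second intact.\<close>

lemma sublist_gen_word_compose_range:
  assumes "standard q"
  shows "sublist (gen_word q a n) (compose_range (ferenczi_directive q a) 0 (Suc (Suc n)) [b])"
proof -
  let ?w = "gen_word q a n" and ?p = "conj_prefix q a n" and ?\<tau> = "ferenczi_directive q a"
  let ?T = "compose_range ?\<tau> 0 (Suc (Suc n)) [b]"
  have q: "2 \<le> q m" "0 < q m" for m
    using assms by (auto simp: standard_def intro: less_le_trans[OF pos2])
  obtain r where r: "?w = ?p @ r"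
    using prefix_conj_prefix[of q a n] q(2) by (auto simp: prefix_def)
  obtain x y ys where xy: "?\<tau> (Suc n) b = x # y # ys"
  proof -
    have "Suc (Suc 0) \<le> length (?\<tau> (Suc n) b)" by simp
    then show ?thesis using that unfolding Suc_le_length_iff by blast
  qed
  have "?T = compose_range ?\<tau> 0 (Suc n) (x # y # ys)"
    by (subst compose_range_Suc) (simp_all add: morphism_def xy del: ferenczi_directive.simps)
  then have "?p @ ?T = concat (map (\<lambda>b. ?w @ replicate b 1) (x # y # ys)) @ ?p"
    using conj_prefix_compose_range[of q a n] q(2) by metis
  also have "\<dots> = ?p @ (r @ replicate x 1) @ ?w
      @ (replicate y 1 @ concat (map (\<lambda>b. ?w @ replicate b 1) ys) @ ?p)"
    by (simp add: r)
  finally show ?thesis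
    unfolding same_append_eq sublist_def by blast
qed

lemma sadic_eq_ferenczi:
  assumes "standard q"
  shows "sadic_subshift (ferenczi_alphabet q a) (ferenczi_directive q a) = ferenczi_subshift q a"
proof -
  have q: "0 < q m" for m
    using assms unfolding standard_def by (metis less_le_trans pos2)
  have "(\<exists>N>0. \<exists>b\<in>ferenczi_alphabet q a N.
          sublist u (compose_range (ferenczi_directive q a) 0 N [b]))
      \<longleftrightarrow> (\<exists>n. sublist u (gen_word q a n))" (is "?L \<longleftrightarrow> ?R") for u
  proof
    assume ?L
    then obtain n b where "b \<in> ferenczi_alphabet q a (Suc n)"
      and u: "sublist u (compose_range (ferenczi_directive q a) 0 (Suc n) [b])"
      by (metis gr0_conv_Suc)
    then obtain N i where b: "b = a N i" "n \<le> N" "i < q N" by auto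
    note u
    also have "sublist (compose_range (ferenczi_directive q a) 0 (Suc n) [b]) (gen_word q a (Suc N))"
      unfolding b(1) using q b(2,3) by (rule sublist_compose_range_gen_word)
    finally show ?R ..
  next
    assume ?R
    then obtain n where "sublist u (gen_word q a n)" by blast
    then have "sublist u (compose_range (ferenczi_directive q a) 0 (Suc (Suc n)) [a (Suc n) 0])"
      using sublist_gen_word_compose_range[OF assms] by (rule sublist_order.order.trans)
    moreover have "a (Suc n) 0 \<in> ferenczi_alphabet q a (Suc (Suc n))"
      using q by auto
    ultimately show ?L by blast
  qed
  then show ?thesis
    by (simp add: sadic_subshift_def ferenczi_subshift_def)
qed

section \<open>Passing to a standard sequence\<close>

lemma gen_word_length_unbounded:
  assumes "x \<in> ferenczi_subshift q a"
  shows "\<exists>n. k \<le> length (gen_word q a n)"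
proof -
  have "map x [1..int k] \<in> factors x"
    by (auto simp: factors_def)
  then obtain n where "sublist (map x [1..int k]) (gen_word q a n)"
    using assms by (auto simp: ferenczi_subshift_def)
  then show ?thesis
    using sublist_length_le by fastforce
qed

lemma gen_word_two_cuts:
  assumes "bounded_spacers q a" "ferenczi_subshift q a \<noteq> {}"
  shows "\<exists>n s. m < n \<and> 2 \<le> length s \<and> set s \<subseteq> {a N i | N i. i < q N}
    \<and> gen_word q a n = spaced (gen_word q a m) s"
proof -
  obtain B where B: "\<And>n i. i < q n \<Longrightarrow> a n i \<le> B"
    using assms(1) by (auto simp: bounded_spacers_def)
  let ?l = "\<lambda>n. length (gen_word q a n)"
  \<comment> \<open>With at most one spacer, \<open>spaced\<close> yields a word of length at most
    \<open>2 * ?l m + B\<close>; a longer w_n therefore forces two cuts.\<close>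
  obtain n where n: "Suc (2 * ?l m + B) \<le> ?l n"
    using assms(2) gen_word_length_unbounded by blast
  have "m < n"
  proof (rule ccontr)
    assume "\<not> m < n"
    then have "?l n \<le> ?l m"
      by (intro prefix_length_le prefix_gen_word) simp
    then show False using n by simp
  qed
  then obtain s where s: "set s \<subseteq> {a N i | N i. i < q N}"
      "gen_word q a n = spaced (gen_word q a m) s"
    using gen_word_spaced[of m n a q] by auto
  have "2 \<le> length s"
  proof (rule ccontr)
    assume "\<not> 2 \<le> length s"
    then consider "s = []" | c where "s = [c]"
      by (cases s; cases "tl s") auto
    then show False
    proof cases
      case 2
      then have "c \<le> B" using s(1) B by auto
      then show False using n s(2) 2 by (simp add: spaced_Cons)
    qed (use n s(2) in simp)
  qed
  then show ?thesis using \<open>m < n\<close> s by blast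
qed

lemma ferenczi_subshift_standard:
  assumes "bounded_spacers q a" "ferenczi_subshift q a \<noteq> {}"
  shows "\<exists>q' a'. standard q' \<and> bounded_spacers q' a' \<and>
    ferenczi_subshift q' a' = ferenczi_subshift q a"
proof -
  have "\<forall>m. \<exists>n s. m < n \<and> 2 \<le> length s \<and> set s \<subseteq> {a N i | N i. i < q N}
      \<and> gen_word q a n = spaced (gen_word q a m) s"
    using gen_word_two_cuts[OF assms] by blast
  then obtain f s where fs: "\<And>m. m < f m" "\<And>m. 2 \<le> length (s m)"
      "\<And>m. set (s m) \<subseteq> {a N i | N i. i < q N}"
      "\<And>m. gen_word q a (f m) = spaced (gen_word q a m) (s m)"
    unfolding choice_iff by blast
  \<comment> \<open>Iterating from 0 keeps the initial word \<open>[0]\<close>, as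
    \<open>gen_word\<close> demands of the new sequence.\<close>
  define n where "n k = (f ^^ k) 0" for k
  define q' where "q' k = length (s (n k))" for k
  define a' where "a' k i = s (n k) ! i" for k i
  have word: "gen_word q' a' k = gen_word q a (n k)" for k
  proof (induction k)
    case (Suc k)
    have "map (a' k) [0..<q' k] = s (n k)"
      by (simp add: a'_def[abs_def] q'_def map_nth)
    then show ?case using Suc fs(4)[of "n k"] by (simp add: gen_word_Suc n_def)
  qed (simp add: n_def)
  have "standard q'"
    using fs(2) by (simp add: standard_def q'_def)
  moreover have "bounded_spacers q' a'"
  proof -
    obtain B where B: "\<And>n i. i < q n \<Longrightarrow> a n i \<le> B"
      using assms(1) by (auto simp: bounded_spacers_def)
    have "a' k i \<le> B" if "i < q' k" for k i
    proof -
      have "a' k i \<in> {a N i | N i. i < q N}"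
        using that fs(3)[of "n k"] nth_mem unfolding a'_def q'_def by blast
      then show ?thesis using B by auto
    qed
    then show ?thesis by (auto simp: bounded_spacers_def)
  qed
  moreover have "(\<exists>k. sublist u (gen_word q' a' k)) \<longleftrightarrow> (\<exists>k. sublist u (gen_word q a k))" for u
  proof
    assume "\<exists>k. sublist u (gen_word q a k)"
    then obtain k where u: "sublist u (gen_word q a k)" by blast
    \<comment> \<open>This gives \<open>k \<le> n k\<close>, so w_k is a prefix of the k-th word of
      the subsequence.\<close>
    have "strict_mono n"
      using fs(1) by (simp add: strict_mono_Suc_iff n_def)
    then have "prefix (gen_word q a k) (gen_word q' a' k)"
      unfolding word by (intro prefix_gen_word) (rule strict_mono_imp_increasing)
    then show "\<exists>k. sublist u (gen_word q' a' k)"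
      using u prefix_imp_sublist sublist_order.order.trans by blast
  qed (auto simp: word)
  ultimately show ?thesis
    by (intro exI[of _ q'] exI[of _ a']) (simp add: ferenczi_subshift_def)
qed

theorem theorem3p7:
  fixes X :: "(int \<Rightarrow> nat) set"
  assumes "subshift {0, 1} X" and "aperiodic X"
  shows "minimal_ferenczi_subshift X \<longleftrightarrow>
    (\<exists>q a. standard q \<and> bounded_spacers q a \<and>
           X = sadic_subshift (ferenczi_alphabet q a) (ferenczi_directive q a))"
proof
  assume "minimal_ferenczi_subshift X"
  then obtain q a where "bounded_spacers q a" and X: "X = ferenczi_subshift q a"
    by (auto simp: minimal_ferenczi_subshift_def)
  \<comment> \<open>Aperiodicity supplies the point whose long factors make the lengths of the w_n
    unbounded.\<close>
  moreover have "X \<noteq> {}"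
    using assms(2) by (simp add: aperiodic_def)
  ultimately obtain q' a' where "standard q'" "bounded_spacers q' a'" "X = ferenczi_subshift q' a'"
    using ferenczi_subshift_standard by metis
  then show "\<exists>q a. standard q \<and> bounded_spacers q a \<and>
      X = sadic_subshift (ferenczi_alphabet q a) (ferenczi_directive q a)"
    using sadic_eq_ferenczi by metis
next
  assume "\<exists>q a. standard q \<and> bounded_spacers q a \<and>
      X = sadic_subshift (ferenczi_alphabet q a) (ferenczi_directive q a)"
  then show "minimal_ferenczi_subshift X"
    using assms(1) sadic_eq_ferenczi unfolding minimal_ferenczi_subshift_def by metis
qed

end
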